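(* Let $a,b>0$, let $\mathcal{E}$ be the ellipse $\frac{x^2}{a}+\frac{y^2}{b}=1$ in the Minkowski plane, and let $n=2m$ with $m\ge1$ an integer. A light-like billiard trajectory within $\mathcal{E}$ is periodic with period $n=2m$ if and only if there exist real polynomials $\hat p_m(s)$ and $\hat q_{m-1}(s)$ of degrees $m$ and $m-1$ respectively such that $$\hat p_m^2(s)-\left(s-\frac1a\right)\left(s+\frac1b\right)\hat q_{m-1}^2(s)=1\qquad\text{and}\qquad \hat q_{m-1}(0)=0.$$
   Context: The Minkowski plane is $\mathbb{R}^2$ with the scalar product $\langle X,Y\rangle=X_1Y_1-X_2Y_2$; vectors $X,Y$ are orthogonal if $\langle X,Y\rangle=0$, and $v$ is light-like if $\langle v,v\rangle=0$. Billiard reflection: given a line $p$ that is not light-like and a vector $v$, write $v=u+w$ with $u$ parallel to $p$ and $w$ orthogonal to $p$ (in the Minkowski sense); the reflection of $v$ on $p$ is $u-w$. A billiard trajectory within $\mathcal{E}$ is a polygonal line with vertices on $\mathcal{E}$ such that the directions of consecutive segments are billiard reflections of each other with respect to the tangent line of $\mathcal{E}$ at the common vertex (the reflection is not defined where this tangent line is light-like). The trajectory is light-like if all its segments have light-like direction vectors. "Periodic with period $n$" means that the trajectory closes after $n$ reflections ($n$ is not required to be the minimal such number). *)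

theory Defs
  imports "HOL-Analysis.Product_Vector" "HOL-Computational_Algebra.Polynomial"
begin

definition mink :: "real \<times> real \<Rightarrow> real \<times> real \<Rightarrow> real" where
  "mink X Y = fst X * fst Y - snd X * snd Y"

definition light_like :: "real \<times> real \<Rightarrow> bool" where
  "light_like v \<longleftrightarrow> mink v v = 0"

text \<open>The parameters are the squares of the semi-axes.\<close>

definition ellipse :: "real \<Rightarrow> real \<Rightarrow> (real \<times> real) set" where
  "ellipse a b = {X. (fst X)\<^sup>2 / a + (snd X)\<^sup>2 / b = 1}"

text \<open>The usual polar equation of the tangent; meaningful for \<open>P\<close> on the ellipse.\<close>

definition tangent_line :: "real \<Rightarrow> real \<Rightarrow> real \<times> real \<Rightarrow> (real \<times> real) set" where
  "tangent_line a b P = {X. fst P * fst X / a + snd P * snd X / b = 1}"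

definition line_directions :: "(real \<times> real) set \<Rightarrow> (real \<times> real) set" where
  "line_directions L = {X - Y | X Y. X \<in> L \<and> Y \<in> L}"

definition light_like_line :: "(real \<times> real) set \<Rightarrow> bool" where
  "light_like_line L \<longleftrightarrow> (\<exists>d \<in> line_directions L. d \<noteq> 0 \<and> light_like d)"

text \<open>\<open>billiard_reflection L v v'\<close>: the reflection of \<open>v\<close> on the line \<open>L\<close> is defined and
  equal to \<open>v'\<close>.  If \<open>L\<close> is not light-like, the decomposition \<open>v = u + w\<close> exists and is unique.\<close>

definition billiard_reflection ::
    "(real \<times> real) set \<Rightarrow> real \<times> real \<Rightarrow> real \<times> real \<Rightarrow> bool" where
  "billiard_reflection L v v' \<longleftrightarrow> \<not> light_like_line L \<and>
     (\<exists>u w. v = u + w \<and> u \<in> line_directions L \<and> (\<forall>d \<in> line_directions L. mink w d = 0)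
        \<and> v' = u - w)"

text \<open>A trajectory is given by the infinite sequence of its vertices.  Directions are oriented,
  hence taken up to a positive factor.  At every vertex after the initial one the reflection
  must be defined, so trajectories that reach a point with light-like tangent are excluded.\<close>

definition billiard_trajectory :: "real \<Rightarrow> real \<Rightarrow> (nat \<Rightarrow> real \<times> real) \<Rightarrow> bool" where
  "billiard_trajectory a b P \<longleftrightarrow>
     (\<forall>i. P i \<in> ellipse a b) \<and>
     (\<forall>i. P (Suc i) \<noteq> P i) \<and>
     (\<forall>i. \<exists>c>0. billiard_reflection (tangent_line a b (P (Suc i)))
                 (P (Suc i) - P i) (c *\<^sub>R (P (Suc (Suc i)) - P (Suc i))))"

definition light_like_trajectory :: "(nat \<Rightarrow> real \<times> real) \<Rightarrow> bool" where
  "light_like_trajectory P \<longleftrightarrow> (\<forall>i. light_like (P (Suc i) - P i))"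

definition periodic_with :: "nat \<Rightarrow> (nat \<Rightarrow> real \<times> real) \<Rightarrow> bool" where
  "periodic_with n P \<longleftrightarrow> (\<forall>i. P (i + n) = P i)"

end

theory Submission
  imports Defs
begin

text \<open>
  On the ellipse parametrised by \<open>(\<surd>a cos t, \<surd>b sin t)\<close>, a chord in a light-like direction acts on
  the parameter by \<open>t \<mapsto> - t - 2\<delta>\<close> or \<open>t \<mapsto> - t + 2\<delta>\<close>, where \<open>tan \<delta> = \<surd>(b/a)\<close>.  Reflections make
  the two light-like directions alternate, so two steps of the billiard shift \<open>t\<close> by \<open>\<plusminus>4\<delta>\<close> and the
  period divides \<open>2m\<close> iff \<open>sin (2m\<delta>) = 0\<close>.  The Pell equation, on the other hand, is solved by
  \<open>p = \<plusminus>T\<^sub>m\<close> and a multiple \<open>q\<close> of \<open>U\<^sub>m\<^sub>-\<^sub>1\<close> (Chebyshev polynomials) in the affine variable sending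
  \<open>[-1/b, 1/a]\<close> to \<open>[-1, 1]\<close>; it sends \<open>0\<close> to \<open>cos 2\<delta>\<close>, where \<open>U\<^sub>m\<^sub>-\<^sub>1\<close> is \<open>sin (2m\<delta>) / sin 2\<delta>\<close>.
\<close>

section \<open>The polynomial Pell equation\<close>

lemma lead_coeff_add_pos:
  fixes p q :: "real poly"
  assumes "degree p = n" "degree q = n" "lead_coeff p > 0" "lead_coeff q > 0"
  shows "degree (p + q) = n" "lead_coeff (p + q) > 0"
proof -
  have pos: "coeff (p + q) n > 0"
    using assms by auto
  show deg: "degree (p + q) = n"
    using pos assms by (intro antisym degree_add_le le_degree) auto
  show "lead_coeff (p + q) > 0"
    using pos deg by simp
qed

text \<open>The solutions are the powers of the fundamental solution \<open>X + R * sqrt D\<close>.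
  Positive leading coefficients are carried through the induction so that no cancellation lowers the
  degrees.\<close>

lemma pell_solution_exists:
  fixes \<mu> r :: real
  assumes "r > 0"
  defines "D \<equiv> [:- (\<mu> + r), 1:] * [:- (\<mu> - r), 1:]"
  shows "\<exists>p q. degree p = Suc n \<and> degree q = n \<and> lead_coeff p > 0 \<and> lead_coeff q > 0 \<and>
    p\<^sup>2 - D * q\<^sup>2 = 1"
proof -
  \<comment> \<open>\<open>X\<close> is the affine map sending \<open>\<mu> - r\<close> and
    \<open>\<mu> + r\<close> to -1 and 1, so \<open>X\<^sup>2 - 1\<close> is \<open>D\<close>
    divided by \<open>r\<^sup>2\<close>, which dictates \<open>R\<close>.\<close>
  define X where "X = [:- \<mu> / r, 1 / r:]"
  define R where "R = [:1 / r:]"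
  have D: "degree D = 2" "lead_coeff D > 0"
    unfolding D_def by (auto simp: degree_mult_eq lead_coeff_mult simp del: mult_pCons_left)
  have X: "degree X = 1" "lead_coeff X > 0" and R: "degree R = 0" "lead_coeff R > 0"
    using assms(1) by (auto simp: X_def R_def)
  have XR: "X\<^sup>2 - D * R\<^sup>2 = 1"
    using assms(1) by (simp add: X_def R_def D_def power2_eq_square field_simps)
  show ?thesis
  proof (induction n)
    case 0
    show ?case using X R XR by (intro exI[of _ X] exI[of _ R]) simp
  next
    case (Suc n)
    then obtain p q where pq: "degree p = Suc n" "degree q = n" "lead_coeff p > 0"
      "lead_coeff q > 0" "p\<^sup>2 - D * q\<^sup>2 = 1"
      by blast
    have nz: "p \<noteq> 0" "q \<noteq> 0" "X \<noteq> 0" "R \<noteq> 0" "D \<noteq> 0"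
      using pq X R D by auto
    have deg: "degree (X * p) = Suc (Suc n)" "degree (D * R * q) = Suc (Suc n)"
      "degree (X * q) = Suc n" "degree (R * p) = Suc n"
      using pq X R D nz by (simp_all add: degree_mult_eq)
    have lead: "lead_coeff (X * p) > 0" "lead_coeff (D * R * q) > 0"
      "lead_coeff (X * q) > 0" "lead_coeff (R * p) > 0"
      unfolding lead_coeff_mult using pq(3,4) X R D by (auto intro!: mult_pos_pos)
    note P = lead_coeff_add_pos[OF deg(1,2) lead(1,2)]
    note Q = lead_coeff_add_pos[OF deg(3,4) lead(3,4)]
    \<comment> \<open>Brahmagupta's identity: the norm form is multiplicative.\<close>
    have "(X * p + D * R * q)\<^sup>2 - D * (X * q + R * p)\<^sup>2 = (X\<^sup>2 - D * R\<^sup>2) * (p\<^sup>2 - D * q\<^sup>2)"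
      by (simp add: power2_eq_square algebra_simps)
    then have "(X * p + D * R * q)\<^sup>2 - D * (X * q + R * p)\<^sup>2 = 1"
      using XR pq by simp
    with P Q show ?case by blast
  qed
qed

text \<open>The derivative of a solution is a multiple of its second component: \<open>q\<close> divides \<open>2 p p'\<close> and
  is coprime to \<open>p\<close>.\<close>

lemma pell_pderiv:
  fixes D p q :: "real poly"
  assumes D: "degree D = 2" "lead_coeff D = 1"
    and p: "degree p = m" and q: "degree q = m - 1" and m: "m \<ge> 1"
    and pell: "p\<^sup>2 - D * q\<^sup>2 = 1"
  obtains c where "c\<^sup>2 = (real m)\<^sup>2" "pderiv p = smult c q"
proof -
  have eq: "p\<^sup>2 = 1 + D * q\<^sup>2"
    using pell by (simp add: algebra_simps)
  have q0: "q \<noteq> 0"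
  proof
    assume "q = 0"
    with eq have "p\<^sup>2 = 1" by simp
    then have "degree (p\<^sup>2) = 0" by simp
    then show False using p m by (cases "p = 0") (auto simp: degree_power_eq)
  qed
  have D0: "D \<noteq> 0" using D by auto
  have deg: "degree (D * q\<^sup>2) = 2 * m"
    using q0 D0 D q m by (simp add: degree_mult_eq degree_power_eq)
  \<comment> \<open>Both polynomials have degree \<open>2 * m > 0\<close> and differ by 1. Since
    this compares only squares, \<open>c\<close> will be known up to sign.\<close>
  have "lead_coeff (p\<^sup>2) = lead_coeff (D * q\<^sup>2)"
    unfolding eq using deg m by (intro lead_coeff_add_le) auto
  then have lead: "(lead_coeff p)\<^sup>2 = (lead_coeff q)\<^sup>2"
    using D by (simp add: lead_coeff_mult lead_coeff_power)
  have "pderiv (p\<^sup>2 - D * q\<^sup>2) = 0"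
    using pell by simp
  then have "2 * p * pderiv p = q * (pderiv D * q + 2 * D * pderiv q)"
    by (simp add: power2_eq_square pderiv_mult pderiv_diff algebra_simps)
  \<comment> \<open>The extra factor \<open>p\<close> makes \<open>p\<^sup>2\<close> appear, which
    the Pell equation replaces by \<open>1 + D * q\<^sup>2\<close>: an explicit Bezout relation for
    \<open>p\<close> and \<open>q\<close>.\<close>
  then have "2 * pderiv p * p\<^sup>2 = q * ((pderiv D * q + 2 * D * pderiv q) * p)"
    by (simp add: power2_eq_square algebra_simps)
  then have "2 * pderiv p = q * ((pderiv D * q + 2 * D * pderiv q) * p - 2 * D * q * pderiv p)"
    unfolding eq by (simp add: power2_eq_square algebra_simps)
  then obtain k where k: "2 * pderiv p = q * k" by blast
  have pd: "degree (pderiv p) = m - 1" "pderiv p \<noteq> 0"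
    using p m by (auto simp: degree_pderiv pderiv_eq_0_iff)
  have k0: "k \<noteq> 0" using k pd by auto
  have two: "(2 :: real poly) = [:2:]"
    by (simp add: numeral_poly)
  have "degree (2 * pderiv p) = m - 1"
    using pd by (simp add: two)
  then have "degree k = 0"
    using k k0 q0 q by (simp add: degree_mult_eq)
  then obtain d where d: "k = [:d:]"
    using degree_eq_zeroE by blast
  have "smult 2 (pderiv p) = smult d q"
    using k d by (simp add: two)
  then have c: "pderiv p = smult (d / 2) q"
    by (metis divide_eq_1_iff mult.commute smult_1_left smult_smult times_divide_eq_right
        zero_neq_numeral mult.right_neutral)
  have "lead_coeff (pderiv p) = real m * lead_coeff p"
    using m p pd by (simp add: coeff_pderiv)
  moreover have "lead_coeff (pderiv p) = d / 2 * lead_coeff q"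
    unfolding c by (simp only: lead_coeff_smult)
  ultimately have "(real m * lead_coeff p)\<^sup>2 = (d / 2 * lead_coeff q)\<^sup>2"
    by simp
  then have "(d / 2)\<^sup>2 = (real m)\<^sup>2"
    using lead q0 unfolding power_mult_distrib by simp
  with c show ?thesis using that by blast
qed

text \<open>Chebyshev's differential equation. Eliminating \<open>q\<close> from the Pell equation
  shows that \<open>m\<^sup>2 p\<^sup>2 - D p'\<^sup>2\<close> is constant; differentiate and cancel
  \<open>p'\<close>.\<close>

lemma pell_ode:
  fixes D p q :: "real poly"
  assumes D: "degree D = 2" "lead_coeff D = 1"
    and p: "degree p = m" and q: "degree q = m - 1" and m: "m \<ge> 1"
    and pell: "p\<^sup>2 - D * q\<^sup>2 = 1"
  shows "2 * smult ((real m)\<^sup>2) p = pderiv D * pderiv p + 2 * D * pderiv (pderiv p)"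
proof -
  obtain c where c: "c\<^sup>2 = (real m)\<^sup>2" "pderiv p = smult c q"
    using pell_pderiv[OF assms] .
  have "smult ((real m)\<^sup>2) (p\<^sup>2 - D * q\<^sup>2) = smult ((real m)\<^sup>2) 1"
    using pell by simp
  then have "smult ((real m)\<^sup>2) (p\<^sup>2) - D * (pderiv p)\<^sup>2 = smult ((real m)\<^sup>2) 1"
    unfolding c(2) c(1)[symmetric] by (simp add: smult_diff_right power2_eq_square)
  then have "pderiv (smult ((real m)\<^sup>2) (p\<^sup>2) - D * (pderiv p)\<^sup>2) = 0"
    by (simp add: pderiv_smult)
  then have "pderiv p * (2 * smult ((real m)\<^sup>2) p) =
      pderiv p * (pderiv D * pderiv p + 2 * D * pderiv (pderiv p))"
    by (simp add: power2_eq_square pderiv_mult pderiv_diff pderiv_smult algebra_simps)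
  moreover have "pderiv p \<noteq> 0"
    using p m by (auto simp: pderiv_eq_0_iff)
  ultimately show ?thesis using mult_left_cancel by blast
qed

lemma harmonic_oscillator_unique:
  fixes f g :: "real \<Rightarrow> real"
  assumes f: "\<And>t. (f has_real_derivative g t) (at t)"
    and g: "\<And>t. (g has_real_derivative - k\<^sup>2 * f t) (at t)"
    and init: "g 0 = 0"
  shows "g t = - k * f 0 * sin (k * t)"
proof -
  \<comment> \<open>In the frame rotating with angular speed \<open>k\<close>, the coordinates
    \<open>C\<close> and \<open>S\<close> of the phase point are constant.\<close>
  define C where "C t = k * f t * cos (k * t) - g t * sin (k * t)" for t
  define S where "S t = k * f t * sin (k * t) + g t * cos (k * t)" for t
  have "(C has_real_derivative 0) (at t)" for t
    unfolding C_def
    by (auto intro!: derivative_eq_intros f g simp: power2_eq_square algebra_simps)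
  then have C: "C t = k * f 0"
    using DERIV_isconst_all[of C t 0] init by (simp add: C_def)
  have "(S has_real_derivative 0) (at t)" for t
    unfolding S_def
    by (auto intro!: derivative_eq_intros f g simp: power2_eq_square algebra_simps)
  then have S: "S t = 0"
    using DERIV_isconst_all[of S t 0] init by (simp add: S_def)
  have "g t = g t * ((sin (k * t))\<^sup>2 + (cos (k * t))\<^sup>2)"
    by simp
  also have "\<dots> = S t * cos (k * t) - C t * sin (k * t)"
    unfolding S_def C_def by algebra
  finally show ?thesis using C S by simp
qed

text \<open>In the variable \<open>\<theta>\<close> with \<open>s = \<mu> + r cos \<theta>\<close> the differential equation for \<open>p\<close> is that of the
  harmonic oscillator, so \<open>p\<close> is \<open>\<plusminus>cos (m\<theta>)\<close>.\<close>

lemma pell_root_iff: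
  fixes p q :: "real poly" and \<mu> r \<theta> :: real
  defines "D \<equiv> [:- (\<mu> + r), 1:] * [:- (\<mu> - r), 1:]"
  assumes p: "degree p = m" and q: "degree q = m - 1" and m: "m \<ge> 1"
    and pell: "p\<^sup>2 - D * q\<^sup>2 = 1"
    and r: "r \<noteq> 0" and \<theta>: "sin \<theta> \<noteq> 0"
  shows "poly q (\<mu> + r * cos \<theta>) = 0 \<longleftrightarrow> sin (real m * \<theta>) = 0"
proof -
  have D: "degree D = 2" "lead_coeff D = 1"
    unfolding D_def by (auto simp: degree_mult_eq lead_coeff_mult simp del: mult_pCons_left)
  define x where "x t = \<mu> + r * cos t" for t
  define f where "f t = poly p (x t)" for t
  define g where "g t = - r * sin t * poly (pderiv p) (x t)" for t
  have x: "(x has_real_derivative - r * sin t) (at t)" for t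
    unfolding x_def by (auto intro!: derivative_eq_intros)
  have poly_x: "((\<lambda>t. poly h (x t)) has_real_derivative poly (pderiv h) (x t) * (- r * sin t)) (at t)"
    for h t
    by (rule DERIV_chain2[OF poly_DERIV x])
  have f: "(f has_real_derivative g t) (at t)" for t
    unfolding f_def g_def using poly_x[of p t] by (simp add: mult_ac)
  have g: "(g has_real_derivative - (real m)\<^sup>2 * f t) (at t)" for t
  proof -
    have Dx: "poly D (x t) = - (r\<^sup>2 * (sin t)\<^sup>2)"
      unfolding D_def x_def sin_squared_eq by (simp add: power2_eq_square algebra_simps)
    have D'x: "poly (pderiv D) (x t) = 2 * r * cos t"
      unfolding D_def x_def by (simp add: pderiv_pCons pderiv_mult algebra_simps)
    have "poly (2 * smult ((real m)\<^sup>2) p) (x t) =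
        poly (pderiv D * pderiv p + 2 * D * pderiv (pderiv p)) (x t)"
      using pell_ode[OF D p q m pell] by simp
    then have "(real m)\<^sup>2 * f t = r * cos t * poly (pderiv p) (x t) -
        r\<^sup>2 * (sin t)\<^sup>2 * poly (pderiv (pderiv p)) (x t)"
      by (simp add: Dx D'x f_def)
    then show ?thesis
      unfolding g_def
      by (auto intro!: derivative_eq_intros x simp: power2_eq_square algebra_simps)
  qed
  have "g \<theta> = - real m * f 0 * sin (real m * \<theta>)"
    by (rule harmonic_oscillator_unique[OF f g]) (simp add: g_def)
  \<comment> \<open>At the root \<open>\<mu> + r\<close> of \<open>D\<close> the Pell equation
    forces \<open>p\<^sup>2 = 1\<close>.\<close>
  moreover have "f 0 \<noteq> 0"
  proof -
    have "poly (p\<^sup>2 - D * q\<^sup>2) (\<mu> + r) = 1"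
      using pell by simp
    moreover have "poly D (\<mu> + r) = 0"
      by (simp add: D_def algebra_simps)
    ultimately show ?thesis by (auto simp: f_def x_def)
  qed
  moreover obtain c where "c\<^sup>2 = (real m)\<^sup>2" "pderiv p = smult c q"
    using pell_pderiv[OF D p q m pell] .
  ultimately show ?thesis
    using r \<theta> m by (auto simp: g_def x_def)
qed

section \<open>Light-like billiards\<close>

lemma light_like_iff: "light_like v \<longleftrightarrow> fst v = snd v \<or> fst v = - snd v"
  by (auto simp: light_like_def mink_def square_eq_iff)

text \<open>If \<open>v\<close> and \<open>v'\<close> lay on the same light-like line, so would the
  tangential part \<open>u\<close>, which then vanishes. Thus \<open>v\<close> is orthogonal to
  \<open>d\<close>; but a light-like vector is orthogonal only to its own multiples, so
  \<open>d\<close> would be light-like.\<close>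

lemma reflection_light_like_alternates:
  fixes v v' :: "real \<times> real"
  assumes e: "e \<in> {1, -1}" "fst v = e * snd v" "v \<noteq> 0"
    and refl: "billiard_reflection L v (c *\<^sub>R v')"
    and L: "d \<in> line_directions L" "d \<noteq> 0"
  shows "fst v' \<noteq> e * snd v'"
proof
  assume v': "fst v' = e * snd v'"
  obtain u w where uw: "v = u + w" "u \<in> line_directions L"
      "\<And>d. d \<in> line_directions L \<Longrightarrow> mink w d = 0" "c *\<^sub>R v' = u - w"
    and nl: "\<not> light_like_line L"
    using refl unfolding billiard_reflection_def by blast
  have "2 *\<^sub>R u = v + c *\<^sub>R v'"
    unfolding uw by (simp add: scaleR_2)
  then have "2 * fst u = fst v + c * fst v'" "2 * snd u = snd v + c * snd v'"
    by (auto simp: prod_eq_iff)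
  then have "fst u = e * snd u"
    using e v' by (auto simp: algebra_simps)
  then have "light_like u"
    using e by (auto simp: light_like_iff)
  then have "u = 0"
    using nl uw unfolding light_like_line_def by blast
  then have "mink v d = 0"
    using uw L by simp
  then have "snd v * (e * fst d - snd d) = 0"
    using e by (simp add: mink_def algebra_simps)
  moreover have "snd v \<noteq> 0"
    using e by (auto simp: prod_eq_iff)
  ultimately have "light_like d"
    using e by (auto simp: light_like_iff)
  then show False
    using nl L unfolding light_like_line_def by blast
qed

text \<open>Supplies the nonzero direction needed to apply the alternation argument to a
  tangent.\<close>

lemma tangent_line_direction:
  assumes "P \<in> ellipse a b" "a \<noteq> 0" "b \<noteq> 0"
  shows "\<exists>d \<in> line_directions (tangent_line a b P). d \<noteq> 0"
proof
  define d where "d = (snd P / b, - fst P / a)"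
  show "d \<noteq> 0"
    using assms by (auto simp: d_def ellipse_def prod_eq_iff)
  have "P \<in> tangent_line a b P" "P + d \<in> tangent_line a b P"
    using assms by (auto simp: d_def tangent_line_def ellipse_def power2_eq_square distrib_left
        right_diff_distrib add_divide_distrib diff_divide_distrib mult_ac)
  moreover have "d = (P + d) - P"
    by simp
  ultimately show "d \<in> line_directions (tangent_line a b P)"
    unfolding line_directions_def by blast
qed

text \<open>For a point of the ellipse with parameter \<open>t\<close> this is
  \<open>cis t\<close>.\<close>

definition circle_point :: "real \<Rightarrow> real \<Rightarrow> real \<times> real \<Rightarrow> complex" where
  "circle_point a b X = Complex (fst X / sqrt a) (snd X / sqrt b)"

lemma norm_circle_point:
  assumes "X \<in> ellipse a b" "a > 0" "b > 0"
  shows "cmod (circle_point a b X) = 1"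
  using assms by (simp add: circle_point_def ellipse_def cmod_def power_divide)

lemma circle_point_eq_iff:
  assumes "a > 0" "b > 0"
  shows "circle_point a b X = circle_point a b Y \<longleftrightarrow> X = Y"
  using assms by (simp add: circle_point_def prod_eq_iff)

lemma unit_complex_eq_Re:
  fixes u v :: complex
  assumes "cmod u = 1" "cmod v = 1" "Re u = Re v" "u \<noteq> v"
  shows "v = cnj u"
proof -
  have "(Re u)\<^sup>2 + (Im u)\<^sup>2 = (Re v)\<^sup>2 + (Im v)\<^sup>2"
    using assms by (metis cmod_power2)
  then have "Im u = Im v \<or> Im u = - Im v"
    using assms by (simp add: power2_eq_iff)
  then show ?thesis
    using assms by (auto simp: complex_eq_iff)
qed

text \<open>After rotation by \<open>e * \<delta>\<close> the real part is proportional to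
  \<open>fst - e * snd\<close>, which is constant along the chord. Two distinct unit numbers with
  equal real part are conjugate.\<close>

lemma light_like_chord:
  assumes ab: "a > 0" "b > 0"
    and \<delta>: "cos \<delta> = sqrt a / sqrt (a + b)" "sin \<delta> = sqrt b / sqrt (a + b)"
    and XY: "X \<in> ellipse a b" "Y \<in> ellipse a b" "X \<noteq> Y"
    and e: "e \<in> {1, -1}" "fst (Y - X) = e * snd (Y - X)"
  shows "circle_point a b Y = cnj (circle_point a b X) * cis (- (2 * e * \<delta>))"
proof -
  let ?z = "circle_point a b"
  let ?u = "\<lambda>Z. ?z Z * cis (e * \<delta>)"
  have ce: "cos (e * \<delta>) = sqrt a / sqrt (a + b)" "sin (e * \<delta>) = e * sqrt b / sqrt (a + b)"
    using e \<delta> by auto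
  have Re: "Re (?u Z) = (fst Z - e * snd Z) / sqrt (a + b)" for Z
    using ab by (simp add: ce circle_point_def diff_divide_distrib)
  have "?u Y = cnj (?u X)"
  proof (rule unit_complex_eq_Re)
    show "cmod (?u X) = 1" "cmod (?u Y) = 1"
      using XY ab by (simp_all add: norm_mult norm_circle_point)
    show "Re (?u X) = Re (?u Y)"
      unfolding Re using e by (auto simp: algebra_simps)
    show "?u X \<noteq> ?u Y"
      using XY ab by (simp add: circle_point_eq_iff)
  qed
  moreover have "?z Y = ?u Y * cis (- (e * \<delta>))"
    by (simp add: mult.assoc cis_mult)
  ultimately have "?z Y = cnj (?z X) * (cis (- (e * \<delta>)) * cis (- (e * \<delta>)))"
    by (simp add: cis_cnj)
  then show ?thesis
    by (simp add: cis_mult mult_ac)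
qed

lemma light_like_directions_alternate:
  assumes ab: "a > 0" "b > 0"
    and traj: "billiard_trajectory a b P" and ll: "light_like_trajectory P"
  obtains e where "e \<in> {1, -1}"
    "\<And>i. fst (P (Suc i) - P i) = (e * (-1) ^ i) * snd (P (Suc i) - P i)"
proof -
  define d where "d i = P (Suc i) - P i" for i
  have d0: "d i \<noteq> 0" for i
    using traj by (simp add: billiard_trajectory_def d_def)
  have dl: "fst (d i) = snd (d i) \<or> fst (d i) = - snd (d i)" for i
    using ll by (simp only: light_like_trajectory_def light_like_iff d_def)
  have step: "fst (d (Suc i)) = - e * snd (d (Suc i))"
    if e: "e \<in> {1, -1}" "fst (d i) = e * snd (d i)" for e i
  proof -
    have "P (Suc i) \<in> ellipse a b"
      using traj by (simp add: billiard_trajectory_def)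
    then obtain t where t: "t \<in> line_directions (tangent_line a b (P (Suc i)))" "t \<noteq> 0"
      using tangent_line_direction ab by (metis less_irrefl)
    obtain c where "billiard_reflection (tangent_line a b (P (Suc i))) (d i) (c *\<^sub>R d (Suc i))"
      using traj unfolding billiard_trajectory_def d_def by blast
    from reflection_light_like_alternates[OF e d0 this t] show ?thesis
      using dl[of "Suc i"] e by auto
  qed
  obtain e where e: "e \<in> {1, -1}" "fst (d 0) = e * snd (d 0)"
    using dl[of 0] by (metis insertCI mult_1 mult_minus1)
  have "fst (d i) = (e * (-1) ^ i) * snd (d i)" for i
  proof (induction i)
    case (Suc i)
    have "e * (-1) ^ i \<in> {1, -1}"
      using e(1) by (cases "even i") auto
    from step[OF this Suc] show ?case by simp
  qed (use e in simp)
  with e(1) show ?thesis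
    using that[of e] by (simp only: d_def)
qed

text \<open>Each step is a conjugation followed by a rotation; with alternating signs, two steps
  compose to a pure rotation by \<open>4 * \<delta>\<close> up to sign. Closing after
  \<open>m\<close> such pairs does not depend on the starting vertex.\<close>

lemma light_like_periodic_iff:
  assumes ab: "a > 0" "b > 0"
    and \<delta>: "cos \<delta> = sqrt a / sqrt (a + b)" "sin \<delta> = sqrt b / sqrt (a + b)"
    and traj: "billiard_trajectory a b P" and ll: "light_like_trajectory P"
  shows "periodic_with (2 * m) P \<longleftrightarrow> sin (real m * (2 * \<delta>)) = 0"
proof -
  obtain e where e: "e \<in> {1, -1}"
    "\<And>i. fst (P (Suc i) - P i) = (e * (-1) ^ i) * snd (P (Suc i) - P i)"
    using light_like_directions_alternate[OF ab traj ll] by blast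
  define s where "s i = e * (-1) ^ i" for i :: nat
  have s: "s i \<in> {1, -1}" for i
    using e by (cases "even i") (auto simp: s_def)
  have sS: "s (Suc i) = - s i" for i
    by (simp add: s_def)
  define z where "z i = circle_point a b (P i)" for i
  have ell: "P i \<in> ellipse a b" and ne: "P i \<noteq> P (Suc i)" for i
    using traj by (auto simp: billiard_trajectory_def dest: sym)
  have z1: "z (Suc i) = cnj (z i) * cis (- (2 * s i * \<delta>))" for i
    unfolding z_def using light_like_chord[OF ab \<delta> ell ell ne s[of i]] e by (simp add: s_def)
  have z2: "z (Suc (Suc i)) = z i * cis (s i * (4 * \<delta>))" for i
    unfolding z1[of "Suc i"] z1[of i]
    by (simp add: cis_cnj mult.assoc cis_mult sS) (simp add: mult_ac)
  have zm: "z (i + 2 * k) = z i * cis (real k * (s i * (4 * \<delta>)))" for i k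
  proof (induction k)
    case (Suc k)
    have "z (i + 2 * Suc k) = z (i + 2 * k) * cis (s (i + 2 * k) * (4 * \<delta>))"
      using z2[of "i + 2 * k"] by simp
    also have "s (i + 2 * k) = s i"
      by (simp add: s_def power_add)
    also have "z (i + 2 * k) * cis (s i * (4 * \<delta>)) =
        z i * (cis (real k * (s i * (4 * \<delta>))) * cis (s i * (4 * \<delta>)))"
      by (simp only: Suc mult.assoc)
    also have "cis (real k * (s i * (4 * \<delta>))) * cis (s i * (4 * \<delta>)) =
        cis (real (Suc k) * (s i * (4 * \<delta>)))"
      by (simp add: cis_mult algebra_simps)
    finally show ?case .
  qed simp
  have "z i \<noteq> 0" for i
    using norm_circle_point[OF ell[of i] ab] by (auto simp: z_def)
  then have "periodic_with (2 * m) P \<longleftrightarrow> (\<forall>i. cis (real m * (s i * (4 * \<delta>))) = 1)"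
    using zm[of _ m] ab by (simp add: periodic_with_def z_def flip: circle_point_eq_iff[OF ab])
  moreover have "cis (real m * (s i * (4 * \<delta>))) = 1 \<longleftrightarrow> sin (real m * (2 * \<delta>)) = 0" for i
  proof -
    let ?\<phi> = "real m * (2 * \<delta>)"
    have "cis (real m * (s i * (4 * \<delta>))) = 1 \<longleftrightarrow> cos (2 * ?\<phi>) = 1 \<and> sin (2 * ?\<phi>) = 0"
      using s[of i] by (auto simp: complex_eq_iff mult_ac)
    also have "\<dots> \<longleftrightarrow> sin ?\<phi> = 0"
      unfolding cos_double_sin sin_double by auto
    finally show ?thesis .
  qed
  ultimately show ?thesis by simp
qed

theorem proposition9p1:
  fixes a b :: real and m n :: nat and P :: "nat \<Rightarrow> real \<times> real"
  assumes "a > 0" and "b > 0" and "m \<ge> 1" and "n = 2 * m"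
    and "billiard_trajectory a b P" and "light_like_trajectory P"
  shows "periodic_with n P \<longleftrightarrow>
    (\<exists>p q :: real poly. degree p = m \<and> degree q = m - 1 \<and>
       p\<^sup>2 - [:- (1 / a), 1:] * [:1 / b, 1:] * q\<^sup>2 = 1 \<and> poly q 0 = 0)"
proof -
  have "(sqrt a / sqrt (a + b))\<^sup>2 + (sqrt b / sqrt (a + b))\<^sup>2 = 1"
    using assms by (simp add: power_divide flip: add_divide_distrib)
  then obtain \<delta> where \<delta>: "cos \<delta> = sqrt a / sqrt (a + b)" "sin \<delta> = sqrt b / sqrt (a + b)"
    by (metis sincos_total_2pi)
  \<comment> \<open>Midpoint and half-length of the interval between the roots \<open>-1/b\<close>
    and \<open>1/a\<close>.\<close>
  define \<mu> r where "\<mu> = (1 / a - 1 / b) / 2" and "r = (1 / a + 1 / b) / 2"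
  have r: "r > 0"
    using assms by (simp add: r_def add_pos_pos)
  have D: "[:- (1 / a), 1:] * [:1 / b, 1:] = [:- (\<mu> + r), 1:] * [:- (\<mu> - r), 1:]"
    by (simp add: \<mu>_def r_def field_simps)
  have sin: "sin (2 * \<delta>) \<noteq> 0"
    using assms by (simp add: sin_double \<delta>)
  have "cos (2 * \<delta>) = (a - b) / (a + b)"
    using assms by (simp add: cos_double \<delta> power_divide diff_divide_distrib)
  \<comment> \<open>The point 0 corresponds to the angle \<open>2 * \<delta>\<close>, the angle in
    the periodicity criterion.\<close>
  then have zero: "\<mu> + r * cos (2 * \<delta>) = 0"
    using assms by (simp add: \<mu>_def r_def divide_simps) (simp add: algebra_simps)
  \<comment> \<open>The condition at 0 holds for all Pell solutions of these degrees or for none, so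
    one existing solution settles both directions.\<close>
  have root: "poly q 0 = 0 \<longleftrightarrow> sin (real m * (2 * \<delta>)) = 0"
    if "degree p = m" "degree q = m - 1" "p\<^sup>2 - [:- (1 / a), 1:] * [:1 / b, 1:] * q\<^sup>2 = 1"
    for p q :: "real poly"
    using pell_root_iff[of p m q \<mu> r "2 * \<delta>"] that assms(3) r sin unfolding D zero by simp
  obtain p q :: "real poly" where "degree p = m" "degree q = m - 1"
    "p\<^sup>2 - [:- (1 / a), 1:] * [:1 / b, 1:] * q\<^sup>2 = 1"
    using pell_solution_exists[OF r, of "m - 1" \<mu>] assms(3) unfolding D by auto
  then show ?thesis
    using light_like_periodic_iff[OF assms(1,2) \<delta> assms(5,6), of m] root assms(4) by metis
qed

end
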